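(* For $n\ge 1$ let $S_n(3\overline{5}241)$ denote the set of permutations of $[n]=\{1,\dots,n\}$ that avoid the barred pattern $3\overline{5}241$. Then the sequence $(a_n)_{n\ge 1}$ defined by $a_1=1$ and $a_{n+1}=|S_n(3\overline{5}241)|$ for $n\ge 1$ is the left-shift eigensequence for self-composition.
   Context: Permutations are written as words $\pi=\pi_1\pi_2\cdots\pi_n$. Occurrences of patterns are as (not necessarily consecutive) subsequences in the same relative order. A permutation $\pi$ avoids the barred pattern $3\overline{5}241$ if every occurrence of the pattern $3241$ in $\pi$ is part of an occurrence of the pattern $35241$; that is, for all positions $i<j<k<l$ such that $\pi_i\pi_j\pi_k\pi_l$ is order-isomorphic to $3241$, there is a position $p$ with $i<p<j$ such that $\pi_i\pi_p\pi_j\pi_k\pi_l$ is order-isomorphic to $35241$ (equivalently, $\pi_p>\pi_k$). The composition of two sequences $(a_n)_{n\ge1}$ and $(b_n)_{n\ge1}$ is defined by composition of their ordinary generating functions $A(x)=\sum_{n\ge1}a_nx^n$ and $B(x)=\sum_{n\ge1}b_nx^n$ as formal power series. A sequence is unital if its first term is $1$. The left-shift eigensequence for self-composition is the unique unital sequence $(b_n)_{n\ge1}$ whose composition with itself equals its left shift $(b_2,b_3,\ldots)$; in terms of $B(x)=\sum_{n\ge1}b_nx^n$, this says $b_1=1$ and $B(B(x))=\sum_{n\ge1}b_{n+1}x^n=\frac{B(x)-x}{x}$. It begins $1,1,2,6,23,104,531,\ldots$. *)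

theory Defs
  imports
    "HOL-Computational_Algebra.Formal_Power_Series"
    "HOL-Combinatorics.Multiset_Permutations"
begin

definition order_isomorphic :: "'a::linorder list \<Rightarrow> 'b::linorder list \<Rightarrow> bool" where
  "order_isomorphic xs ys \<longleftrightarrow>
     length xs = length ys \<and>
     (\<forall>i<length xs. \<forall>j<length xs. xs ! i < xs ! j \<longleftrightarrow> ys ! i < ys ! j)"

text \<open>Positions in words are counted from 0, as usual for lists.\<close>

definition avoids_3_bar5_241 :: "nat list \<Rightarrow> bool" where
  "avoids_3_bar5_241 w \<longleftrightarrow>
     (\<forall>i j k l. i < j \<and> j < k \<and> k < l \<and> l < length w \<and>
        order_isomorphic [w ! i, w ! j, w ! k, w ! l] [3, 2, 4, 1 :: nat] \<longrightarrow>
        (\<exists>p. i < p \<and> p < j \<and>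
           order_isomorphic [w ! i, w ! p, w ! j, w ! k, w ! l] [3, 5, 2, 4, 1 :: nat]))"

definition S_3_bar5_241 :: "nat \<Rightarrow> nat list set" where
  "S_3_bar5_241 n = {w \<in> permutations_of_set {1..n}. avoids_3_bar5_241 w}"

text \<open>
  A sequence indexed by the positive integers is represented by a function on the naturals
  whose value at 0 is irrelevant: the generating function has constant term 0.
\<close>

definition ogf :: "(nat \<Rightarrow> 'a) \<Rightarrow> 'a::comm_ring_1 fps" where
  "ogf b = Abs_fps (\<lambda>n. if n = 0 then 0 else b n)"

definition left_shift_eigensequence :: "(nat \<Rightarrow> 'a::comm_ring_1) \<Rightarrow> bool" where
  "left_shift_eigensequence b \<longleftrightarrow>
     b 1 = 1 \<and> ogf b oo ogf b = ogf (\<lambda>n. b (n + 1))"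

end

theory Submission
  imports Defs "HOL-Library.Infinite_Set"
begin

text \<open>
  Let \<open>s p t\<close> count the avoiders of length \<open>p\<close> whose \<open>t\<close> largest letters appear in increasing order.
  Splitting a permutation at its maximum as \<open>u @ M # v\<close>, it avoids the pattern iff \<open>u\<close> and \<open>v\<close> do and
  the letters of \<open>u\<close> exceeding the minimum of \<open>v\<close> increase; summing over the set of letters of \<open>v\<close>
  gives a recurrence for \<open>s\<close>. With \<open>S(x) = \<Sum>s p 0 x\<^sup>p\<close> and \<open>W = x S(x S(x))\<close>, the recurrence yields
  \<open>s p t = [x\<^sup>p] S W\<^sup>t\<close> by induction on \<open>p\<close>. As \<open>s p 1 = s p 0\<close> for \<open>p > 0\<close>, this means \<open>S = 1 + S W\<close>,
  which for \<open>B = x S\<close> is the eigensequence equation \<open>B(B(x)) = (B - x) / x\<close>.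
\<close>

unbundle fps_syntax

section \<open>Coefficient form and uniqueness of the eigensequence\<close>

text \<open>Writing \<open>B = x S\<close>, the power \<open>B ^ (q + 1)\<close> is
  \<open>x ^ (q + 1) * S ^ (q + 1)\<close>, so comparing coefficients of degree \<open>n + 1\<close>
  in \<open>B(B(x))\<close> leaves a finite sum. It involves only
  \<open>b 1, ..., b (n + 1)\<close>, hence it is a genuine recursion for
  \<open>b (n + 2)\<close>.\<close>

lemma left_shift_eigensequence_iff:
  "left_shift_eigensequence b \<longleftrightarrow> b 1 = 1 \<and>
     (\<forall>n. b (n + 2) = (\<Sum>q\<le>n. b (q + 1) * (Abs_fps (\<lambda>n. b (n + 1)) ^ (q + 1)) $ (n - q)))"
proof -
  define S where "S = Abs_fps (\<lambda>n. b (n + 1))"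
  have B: "ogf b = fps_X * S"
    by (rule fps_ext) (auto simp: ogf_def S_def)
  have comp: "(ogf b oo ogf b) $ Suc n = (\<Sum>q\<le>n. b (q + 1) * (S ^ (q + 1)) $ (n - q))" for n
  proof -
    have "(ogf b oo ogf b) $ Suc n = (\<Sum>i\<in>{0..Suc n}. ogf b $ i * (ogf b ^ i) $ Suc n)"
      by (simp add: fps_compose_nth)
    also have "\<dots> = (\<Sum>q\<in>{0..n}. ogf b $ Suc q * (ogf b ^ Suc q) $ Suc n)"
      by (subst sum.atLeast0_atMost_Suc_shift) (simp add: ogf_def)
    also have "\<dots> = (\<Sum>q\<le>n. b (q + 1) * (S ^ (q + 1)) $ (n - q))"
    proof (rule sum.cong)
      fix q assume "q \<in> {..n}"
      have "ogf b ^ Suc q = fps_X ^ Suc q * S ^ Suc q"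
        unfolding B by (rule power_mult_distrib)
      then have "(ogf b ^ Suc q) $ Suc n = (S ^ Suc q) $ (n - q)"
        using \<open>q \<in> {..n}\<close> by (simp only: fps_X_power_mult_nth) auto
      then show "ogf b $ Suc q * (ogf b ^ Suc q) $ Suc n = b (q + 1) * (S ^ (q + 1)) $ (n - q)"
        by (simp add: ogf_def)
    qed auto
    finally show ?thesis .
  qed
  have "ogf b oo ogf b = ogf (\<lambda>n. b (n + 1)) \<longleftrightarrow>
      (\<forall>n. (ogf b oo ogf b) $ Suc n = b (n + 2))"
  proof
    assume "\<forall>n. (ogf b oo ogf b) $ Suc n = b (n + 2)"
    then show "ogf b oo ogf b = ogf (\<lambda>n. b (n + 1))"
      by (intro fps_ext) (case_tac n, auto simp: ogf_def)
  qed (simp add: ogf_def)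
  then show ?thesis
    unfolding left_shift_eigensequence_def comp S_def[symmetric] by metis
qed

text \<open>A truncated congruence: the inductions below know their series only up to some degree,
  which is all that a single coefficient of a product sees.\<close>

lemma fps_mult_nth_cong:
  assumes "\<And>i. i \<le> n \<Longrightarrow> F $ i = F' $ i" "\<And>i. i \<le> n \<Longrightarrow> G $ i = G' $ i"
  shows "(F * G) $ n = (F' * G') $ n"
  unfolding fps_mult_nth by (rule sum.cong) (use assms in auto)

lemma fps_power_nth_cong:
  assumes "\<And>i. i \<le> n \<Longrightarrow> F $ i = F' $ i"
  shows "(F ^ k) $ n = (F' ^ k) $ n"
  using assms
proof (induction k arbitrary: n)
  case (Suc k)
  then show ?case
    by (simp only: power_Suc) (rule fps_mult_nth_cong, auto)
qed auto

text \<open>Strong induction along the recursion: every entry on its right-hand side has a smaller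
  index.\<close>

lemma left_shift_eigensequence_unique:
  assumes "left_shift_eigensequence a" "left_shift_eigensequence b"
  shows "a (n + 1) = b (n + 1)"
proof (induction n rule: less_induct)
  case (less n)
  show ?case
  proof (cases n)
    case 0
    then show ?thesis using assms by (simp add: left_shift_eigensequence_iff)
  next
    case (Suc m)
    have "(\<Sum>q\<le>m. a (q + 1) * (Abs_fps (\<lambda>n. a (n + 1)) ^ (q + 1)) $ (m - q)) =
        (\<Sum>q\<le>m. b (q + 1) * (Abs_fps (\<lambda>n. b (n + 1)) ^ (q + 1)) $ (m - q))"
    proof (intro sum.cong arg_cong2[where f = "(*)"] refl fps_power_nth_cong)
      fix q i assume "q \<in> {..m}"
      then show "a (q + 1) = b (q + 1)" using less Suc by auto
      assume "i \<le> m - q"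
      then show "Abs_fps (\<lambda>n. a (n + 1)) $ i = Abs_fps (\<lambda>n. b (n + 1)) $ i"
        using less[of i] Suc by auto
    qed
    then show ?thesis
      using assms Suc by (simp add: left_shift_eigensequence_iff)
  qed
qed

section \<open>From a recurrence over subsets to power series\<close>

lemma fps_mult_power_nth_eq_0:
  fixes W :: "'a::comm_ring_1 fps"
  assumes "W $ 0 = 0" "n < k"
  shows "(F * W ^ k) $ n = 0"
proof -
  have "(W ^ k) $ i = 0" if "i < k" for i
    using assms(1) that by (simp add: startsby_zero_power_prefix)
  then show ?thesis
    unfolding fps_mult_nth using assms(2) by (intro sum.neutral) auto
qed

definition above :: "nat \<Rightarrow> nat set \<Rightarrow> nat set" where
  "above N Q = {x\<in>{..<N} - Q. \<exists>y\<in>Q. y < x}"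

lemma above_Suc:
  assumes "Q \<subseteq> {..<N}" "Q \<noteq> {}"
  shows "card (above (Suc N) Q) = Suc (card (above N Q))"
proof -
  have "above (Suc N) Q = insert N (above N Q)"
    using assms by (auto simp: above_def)
  moreover have "N \<notin> above N Q" "finite (above N Q)"
    by (auto simp: above_def)
  ultimately show ?thesis by simp
qed

lemma above_insert:
  "Q \<subseteq> {..<N} \<Longrightarrow> above (Suc N) (insert N Q) = above N Q"
  by (auto simp: above_def)

text \<open>Induction on \<open>N\<close>, splitting by whether the top point \<open>N\<close> lies
  in \<open>Q\<close>. If not, it adds one to \<open>above\<close> and so acts like a step from
  \<open>t\<close> to \<open>t + 1\<close>; if so, \<open>k\<close> drops by one. The two
  contributions add up to \<open>(1 + S * W) * S ^ k * W ^ t\<close>, and \<open>SW\<close> absorbs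
  the first factor into \<open>S\<close>. Both moves preserve \<open>N - k + t = p\<close>, so
  \<open>p\<close> stays fixed.\<close>

lemma sum_subsets_fixed_card:
  fixes S W :: "'a::comm_ring_1 fps"
  assumes s: "\<And>t. t \<le> p \<Longrightarrow> s t = (S * W ^ t) $ p"
    and W0: "W $ 0 = 0"
    and SW: "\<And>i. i \<le> p \<Longrightarrow> S $ i = (1 + S * W) $ i"
  shows "k \<le> N \<Longrightarrow> N - k + t = p \<Longrightarrow>
    (\<Sum>Q | Q \<subseteq> {..<N} \<and> card Q = k. s (t + card (above N Q))) = (S ^ (k + 1) * W ^ t) $ p"
proof (induction N arbitrary: k t)
  case 0
  then have "{Q. Q \<subseteq> {..<0::nat} \<and> card Q = k} = {{}}" "k = 0" by auto
  then show ?case using s 0 by (simp add: above_def)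
next
  case (Suc N)
  show ?case
  proof (cases k)
    case 0
    then have "{Q. Q \<subseteq> {..<Suc N} \<and> card Q = k} = {{}}"
      by (auto simp: finite_subset)
    then show ?thesis using s Suc.prems 0 by (simp add: above_def)
  next
    case (Suc l)
    define C where "C N k = {Q. Q \<subseteq> {..<N} \<and> card Q = k}" for N k :: nat
    have fin: "finite (C N k)" for N k
      by (rule finite_subset[of _ "Pow {..<N}"]) (auto simp: C_def)
    have ne: "Q \<subseteq> {..<N}" "finite Q" "N \<notin> Q" if "Q \<in> C N j" for Q j
      using that by (auto simp: C_def finite_subset)
    have "C (Suc N) k = C N k \<union> insert N ` C N l"
    proof (intro equalityI subsetI)
      fix Q assume Q: "Q \<in> C (Suc N) k"
      show "Q \<in> C N k \<union> insert N ` C N l"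
      proof (cases "N \<in> Q")
        case True
        then have "Q = insert N (Q - {N})" "Q - {N} \<in> C N l"
          using Q Suc by (auto simp: C_def less_Suc_eq)
        then show ?thesis by blast
      next
        case False
        then show ?thesis using Q by (auto simp: C_def less_Suc_eq)
      qed
    next
      fix Q assume "Q \<in> C N k \<union> insert N ` C N l"
      then show "Q \<in> C (Suc N) k"
      proof
        assume "Q \<in> C N k"
        then show ?thesis by (auto simp: C_def less_Suc_eq)
      next
        assume "Q \<in> insert N ` C N l"
        then obtain R where R: "R \<in> C N l" "Q = insert N R" by blast
        then show ?thesis
          using ne[OF R(1)] Suc by (auto simp: C_def less_Suc_eq)
      qed
    qed
    moreover have "C N k \<inter> insert N ` C N l = {}"
      by (auto simp: C_def)
    moreover have "inj_on (insert N) (C N l)"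
      using ne(3) by (meson inj_onI insert_ident)
    ultimately have "(\<Sum>Q\<in>C (Suc N) k. s (t + card (above (Suc N) Q))) =
        (\<Sum>Q\<in>C N k. s (t + card (above (Suc N) Q))) +
        (\<Sum>Q\<in>C N l. s (t + card (above (Suc N) (insert N Q))))"
      by (simp add: sum.union_disjoint fin sum.reindex)
    also have "(\<Sum>Q\<in>C N k. s (t + card (above (Suc N) Q))) =
        (\<Sum>Q\<in>C N k. s (Suc t + card (above N Q)))"
    proof (rule sum.cong)
      fix Q assume "Q \<in> C N k"
      then have "Q \<subseteq> {..<N}" "Q \<noteq> {}" using Suc by (auto simp: C_def)
      then show "s (t + card (above (Suc N) Q)) = s (Suc t + card (above N Q))"
        by (simp add: above_Suc)
    qed simp
    also have "\<dots> = (S ^ (k + 1) * W ^ Suc t) $ p"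
    proof (cases "k \<le> N")
      case True
      then show ?thesis using Suc.IH[of k "Suc t"] Suc.prems by (simp add: C_def)
    next
      \<comment> \<open>Now \<open>k = Suc N\<close>, hence \<open>p = t\<close>: no subset has this
        size, and \<open>W ^ Suc t\<close> starts beyond degree \<open>p\<close>.\<close>
      case False
      then have "C N k = {}"
        using ne(1) by (auto simp: C_def) (metis card_lessThan card_mono finite_lessThan)
      moreover have "(S ^ (k + 1) * W ^ Suc t) $ p = 0"
        using Suc.prems False W0 by (intro fps_mult_power_nth_eq_0) auto
      ultimately show ?thesis by simp
    qed
    also have "(\<Sum>Q\<in>C N l. s (t + card (above (Suc N) (insert N Q)))) =
        (\<Sum>Q\<in>C N l. s (t + card (above N Q)))"
      using ne(1) by (intro sum.cong) (auto simp: above_insert)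
    also have "\<dots> = (S ^ (l + 1) * W ^ t) $ p"
      using Suc.IH[of l t] Suc.prems Suc by (simp add: C_def)
    also have "(S ^ (k + 1) * W ^ Suc t) $ p + (S ^ (l + 1) * W ^ t) $ p =
        ((1 + S * W) * (S ^ k * W ^ t)) $ p"
      unfolding Suc fps_add_nth[symmetric] by (simp add: algebra_simps)
    also have "\<dots> = (S * (S ^ k * W ^ t)) $ p"
      by (rule fps_mult_nth_cong) (simp_all only: SW)
    finally show ?thesis by (simp add: C_def mult.assoc)
  qed
qed

text \<open>The conclusion is the recursion of \<open>left_shift_eigensequence_iff\<close> for
  \<open>b (n + 1) = s n 0\<close>. Grouping the subsets in \<open>rec\<close> by size makes each
  group an instance of \<open>sum_subsets_fixed_card\<close>.\<close>

lemma fps_coeff_eq_of_subset_recurrence: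
  fixes s :: "nat \<Rightarrow> nat \<Rightarrow> 'a::comm_ring_1"
  assumes s00: "s 0 0 = 1"
    and s1: "\<And>p. s (Suc p) 1 = s (Suc p) 0"
    and rec: "\<And>n t. t \<le> n \<Longrightarrow> s (Suc n) (Suc t) =
      (\<Sum>Q\<in>Pow {..<n - t}. s (card Q) 0 * s (n - card Q) (t + card (above (n - t) Q)))"
  shows "s (Suc n) 0 = (\<Sum>q\<le>n. s q 0 * (Abs_fps (\<lambda>n. s n 0) ^ (q + 1)) $ (n - q))"
proof -
  define S where "S = Abs_fps (\<lambda>n. s n 0)"
  \<comment> \<open>This is the composition \<open>S(x S(x))\<close>, the sum of
    \<open>s q 0 * x ^ q * S ^ q\<close> over all \<open>q\<close>, given by its
    coefficients.\<close>
  define Z where "Z = Abs_fps (\<lambda>n. \<Sum>q\<le>n. s q 0 * (S ^ q) $ (n - q))"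
  define W where "W = fps_X * Z"
  have W0: "W $ 0 = 0" by (simp add: W_def)
  have Z: "(\<Sum>q\<le>n. s q 0 * (S ^ q * G) $ (n - q)) = (G * Z) $ n" for G n
  proof -
    \<comment> \<open>A finite partial sum of \<open>Z\<close> that agrees with it up to degree
      \<open>n\<close>.\<close>
    define Y where "Y = (\<Sum>q\<le>n. fps_X ^ q * (fps_const (s q 0) * S ^ q))"
    have Y: "Y $ i = Z $ i" if "i \<le> n" for i
    proof -
      have "Y $ i = (\<Sum>q\<le>n. if i < q then 0 else s q 0 * (S ^ q) $ (i - q))"
        unfolding Y_def fps_sum_nth fps_X_power_mult_nth
        by (intro sum.cong) auto
      also have "\<dots> = (\<Sum>q\<le>i. s q 0 * (S ^ q) $ (i - q))"
        using that by (intro sum.mono_neutral_cong_right) auto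
      finally show ?thesis by (simp add: Z_def)
    qed
    have "(\<Sum>q\<le>n. s q 0 * (S ^ q * G) $ (n - q)) =
        (\<Sum>q\<le>n. (fps_X ^ q * (fps_const (s q 0) * (S ^ q * G))) $ n)"
      by (intro sum.cong) (auto simp: fps_X_power_mult_nth)
    also have "\<dots> = (G * Y) $ n"
      by (simp add: Y_def sum_distrib_left fps_sum_nth mult_ac)
    also have "\<dots> = (G * Z) $ n"
      by (rule fps_mult_nth_cong) (simp_all add: Y)
    finally show ?thesis .
  qed
  have main: "\<forall>t\<le>p. s p t = (S * W ^ t) $ p" for p
  proof (induction p rule: less_induct)
    case (less p)
    show ?case
    proof (intro allI impI)
      fix t assume "t \<le> p"
      show "s p t = (S * W ^ t) $ p"
      proof (cases t)
        case 0
        then show ?thesis by (simp add: S_def)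
      next
        case (Suc r)
        then obtain n where p: "p = Suc n" and r: "r \<le> n"
          using \<open>t \<le> p\<close> by (cases p) auto
        \<comment> \<open>The equation \<open>S = 1 + S W\<close> is so far available only below
          degree \<open>p\<close>: for \<open>i > 0\<close> it is the induction hypothesis at
          \<open>t = 1\<close> combined with \<open>s1\<close>.\<close>
        have SW: "S $ i = (1 + S * W) $ i" if "i \<le> n" for i
        proof (cases i)
          case 0
          then show ?thesis by (simp add: S_def s00 W0)
        next
          case (Suc j)
          then have "s i 1 = (S * W) $ i" using less that p by fastforce
          then show ?thesis using Suc s1[of j] by (simp add: S_def)
        qed
        have inner: "(\<Sum>Q | Q \<subseteq> {..<n - r} \<and> card Q = k. s (n - k) (r + card (above (n - r) Q))) =
            (S ^ (k + 1) * W ^ r) $ (n - k)" if "k \<le> n - r" for k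
          using less p SW W0 that r by (intro sum_subsets_fixed_card) auto
        have cards: "card Q \<le> n - r" if "Q \<subseteq> {..<n - r}" for Q
          using card_mono[OF _ that] by simp
        have "s p t = (\<Sum>Q\<in>Pow {..<n - r}. s (card Q) 0 * s (n - card Q) (r + card (above (n - r) Q)))"
          using rec r p Suc by simp
        also have "\<dots> = (\<Sum>k\<le>n - r. \<Sum>Q | Q \<in> Pow {..<n - r} \<and> card Q = k.
            s (card Q) 0 * s (n - card Q) (r + card (above (n - r) Q)))"
          using cards by (intro sum.group[symmetric]) auto
        also have "\<dots> = (\<Sum>k\<le>n - r. s k 0 * (S ^ (k + 1) * W ^ r) $ (n - k))"
        proof (rule sum.cong)
          fix k assume "k \<in> {..n - r}"
          then show "(\<Sum>Q | Q \<in> Pow {..<n - r} \<and> card Q = k.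
                s (card Q) 0 * s (n - card Q) (r + card (above (n - r) Q))) =
              s k 0 * (S ^ (k + 1) * W ^ r) $ (n - k)"
            by (subst inner[symmetric]) (auto simp: sum_distrib_left intro!: sum.cong)
        qed simp
        \<comment> \<open>For \<open>k > n - r\<close> the added terms vanish because
          \<open>W ^ r\<close> has order at least \<open>r > n - k\<close>. The full range is what
          the expansion of \<open>Z\<close> requires.\<close>
        also have "\<dots> = (\<Sum>k\<le>n. s k 0 * (S ^ k * (S * W ^ r)) $ (n - k))"
        proof (rule sum.mono_neutral_cong_left)
          show "\<forall>k\<in>{..n} - {..n - r}. s k 0 * (S ^ k * (S * W ^ r)) $ (n - k) = 0"
          proof
            fix k assume "k \<in> {..n} - {..n - r}"
            then have "(S ^ k * S * W ^ r) $ (n - k) = 0"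
              using W0 r by (intro fps_mult_power_nth_eq_0) auto
            then show "s k 0 * (S ^ k * (S * W ^ r)) $ (n - k) = 0"
              by (simp add: mult.assoc)
          qed
        qed (auto simp: mult_ac)
        also have "\<dots> = (S * W ^ r * Z) $ n" by (rule Z)
        \<comment> \<open>The remaining factor \<open>x * Z\<close> is one more \<open>W\<close>,
          raising the exponent from \<open>r\<close> to \<open>t\<close>.\<close>
        also have "\<dots> = (fps_X * (S * W ^ r * Z)) $ Suc n" by simp
        also have "\<dots> = (S * W ^ t) $ p"
          by (simp only: W_def p Suc power_Suc mult_ac)
        finally show ?thesis .
      qed
    qed
  qed
  have "s (Suc n) 0 = (S * W) $ Suc n"
    using main[of "Suc n"] s1[of n] by fastforce
  also have "\<dots> = (S * Z) $ n"
    by (simp add: W_def mult.left_commute)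
  also have "\<dots> = (\<Sum>q\<le>n. s q 0 * (S ^ q * S) $ (n - q))"
    by (rule Z[symmetric])
  finally show ?thesis by (simp add: S_def mult.commute)
qed

section \<open>The barred pattern in a word split at its maximum\<close>

text \<open>An occurrence of 3241 already fixes the order of four of the five letters, so the only
  remaining demand on the letter at \<open>p\<close> is to exceed the one playing 4.\<close>

lemma avoids_3_bar5_241_iff:
  "avoids_3_bar5_241 w \<longleftrightarrow>
     (\<forall>i j k l. i < j \<and> j < k \<and> k < l \<and> l < length w \<and>
        w ! l < w ! j \<and> w ! j < w ! i \<and> w ! i < w ! k \<longrightarrow>
        (\<exists>p. i < p \<and> p < j \<and> w ! k < w ! p))"
proof -
  have 4: "order_isomorphic [a, b, c, d] [3, 2, 4, 1 :: nat] \<longleftrightarrow> d < b \<and> b < a \<and> a < c"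
    for a b c d :: nat
    by (auto simp: order_isomorphic_def All_less_Suc2)
  have 5: "order_isomorphic [a, e, b, c, d] [3, 5, 2, 4, 1 :: nat] \<longleftrightarrow>
      d < b \<and> b < a \<and> a < c \<and> c < e"
    for a b c d e :: nat
    by (auto simp: order_isomorphic_def All_less_Suc2)
  show ?thesis
    unfolding avoids_3_bar5_241_def 4 5 by blast
qed

definition increasing_on :: "nat set \<Rightarrow> nat list \<Rightarrow> bool" where
  "increasing_on U w \<longleftrightarrow>
     (\<forall>i j. i < j \<and> j < length w \<and> w ! i \<in> U \<and> w ! j \<in> U \<longrightarrow> w ! i < w ! j)"

text \<open>\<open>U\<close> may contain numbers that are not letters of \<open>w\<close>, so index
  sets need comparing only on \<open>set w\<close>. This allows different descriptions of the same
  letters to be exchanged.\<close>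

lemma increasing_on_mono:
  "increasing_on U w \<Longrightarrow> V \<inter> set w \<subseteq> U \<Longrightarrow> increasing_on V w"
  unfolding increasing_on_def
  by (meson IntI nth_mem order_less_trans subsetD)

text \<open>A letter of \<open>U\<close> to the right of \<open>M\<close> would be a smaller letter
  after a larger one, while \<open>M\<close> itself exceeds everything before it.\<close>

lemma increasing_on_append_max:
  assumes "\<And>x. x \<in> set u \<union> set v \<Longrightarrow> x < M" "M \<in> U"
  shows "increasing_on U (u @ M # v) \<longleftrightarrow> set v \<inter> U = {} \<and> increasing_on U u"
proof
  assume *: "increasing_on U (u @ M # v)"
  have "x \<notin> U" if x: "x \<in> set v" for x
  proof
    assume "x \<in> U"
    obtain i where i: "i < length v" "v ! i = x"
      using x by (auto simp: in_set_conv_nth)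
    have "M < x"
      using *[unfolded increasing_on_def, rule_format, of "length u" "length u + Suc i"]
        i \<open>x \<in> U\<close> assms(2) by (simp add: nth_append)
    then show False using assms(1)[of x] x by simp
  qed
  moreover have "increasing_on U u"
    unfolding increasing_on_def
  proof (intro allI impI)
    fix i j assume "i < j \<and> j < length u \<and> u ! i \<in> U \<and> u ! j \<in> U"
    then show "u ! i < u ! j"
      using *[unfolded increasing_on_def, rule_format, of i j] by (simp add: nth_append)
  qed
  ultimately show "set v \<inter> U = {} \<and> increasing_on U u" by auto
next
  assume *: "set v \<inter> U = {} \<and> increasing_on U u"
  show "increasing_on U (u @ M # v)"
    unfolding increasing_on_def
  proof (intro allI impI)
    fix i j
    assume ij: "i < j \<and> j < length (u @ M # v) \<and> (u @ M # v) ! i \<in> U \<and> (u @ M # v) ! j \<in> U"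
    have "j \<le> length u"
    proof (rule ccontr)
      assume "\<not> j \<le> length u"
      then have "(u @ M # v) ! j \<in> set v"
        using ij by (auto simp: nth_append nth_Cons')
      then show False using * ij by auto
    qed
    then show "(u @ M # v) ! i < (u @ M # v) ! j"
      using ij * assms(1) unfolding increasing_on_def
      by (cases "j = length u") (auto simp: nth_append)
  qed
qed

text \<open>The maximum supplies the barred letter of every occurrence whose first two letters lie on
  different sides of it, and plays the letter 4 for a descent on its left and a smaller letter on
  its right.\<close>

lemma avoids_3_bar5_241_append_max:
  assumes max: "\<And>x. x \<in> set u \<union> set v \<Longrightarrow> x < M" and dist: "distinct u"
  shows "avoids_3_bar5_241 (u @ M # v) \<longleftrightarrow>
    avoids_3_bar5_241 u \<and> avoids_3_bar5_241 v \<and> increasing_on {x. \<exists>y\<in>set v. y < x} u"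
proof
  let ?w = "u @ M # v" and ?m = "length u"
  assume w: "avoids_3_bar5_241 ?w"
  have "avoids_3_bar5_241 u"
    unfolding avoids_3_bar5_241_iff
  proof (intro allI impI, elim conjE)
    fix i j k l
    assume "i < j" "j < k" "k < l" "l < length u" "u ! l < u ! j" "u ! j < u ! i" "u ! i < u ! k"
    then show "\<exists>p>i. p < j \<and> u ! k < u ! p"
      using w[unfolded avoids_3_bar5_241_iff, rule_format, of i j k l]
      by (auto simp: nth_append)
  qed
  moreover have "avoids_3_bar5_241 v"
    unfolding avoids_3_bar5_241_iff
  proof (intro allI impI, elim conjE)
    fix i j k l
    assume *: "i < j" "j < k" "k < l" "l < length v" "v ! l < v ! j" "v ! j < v ! i" "v ! i < v ! k"
    then obtain p where p: "Suc ?m + i < p" "p < Suc ?m + j" "v ! k < ?w ! p"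
      using w[unfolded avoids_3_bar5_241_iff, rule_format,
          of "Suc ?m + i" "Suc ?m + j" "Suc ?m + k" "Suc ?m + l"]
      by (auto simp: nth_append)
    then obtain q where "p = Suc ?m + q"
      by (metis add_lessD1 less_imp_add_positive)
    then show "\<exists>p>i. p < j \<and> v ! k < v ! p"
      using p by (auto simp: nth_append)
  qed
  moreover have "increasing_on {x. \<exists>y\<in>set v. y < x} u"
    unfolding increasing_on_def
  proof (intro allI impI, elim conjE)
    fix i j
    assume ij: "i < j" "j < length u" "u ! i \<in> {x. \<exists>y\<in>set v. y < x}"
      "u ! j \<in> {x. \<exists>y\<in>set v. y < x}"
    then obtain l where l: "l < length v" "v ! l < u ! j"
      by (auto simp: in_set_conv_nth)
    show "u ! i < u ! j"
    proof (rule ccontr)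
      assume "\<not> u ! i < u ! j"
      then have "u ! j < u ! i"
        using ij dist by (metis linorder_neqE_nat nat_less_le nth_eq_iff_index_eq order_less_trans)
      moreover have "u ! i < M" using ij max by simp
      ultimately obtain p where p: "i < p" "p < j" "M < ?w ! p"
        using w[unfolded avoids_3_bar5_241_iff, rule_format, of i j ?m "Suc ?m + l"] ij l
        by (auto simp: nth_append)
      then show False using ij max[of "u ! p"] by (auto simp: nth_append)
    qed
  qed
  ultimately show "avoids_3_bar5_241 u \<and> avoids_3_bar5_241 v \<and>
    increasing_on {x. \<exists>y\<in>set v. y < x} u" by blast
next
  let ?w = "u @ M # v" and ?m = "length u"
  assume *: "avoids_3_bar5_241 u \<and> avoids_3_bar5_241 v \<and> increasing_on {x. \<exists>y\<in>set v. y < x} u"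
  have le: "?w ! i \<le> M" if "i < length ?w" for i
    using nth_mem[OF that] max by (auto intro: less_imp_le)
  have lt: "?w ! i < M" if "i < length ?w" "i \<noteq> ?m" for i
  proof -
    have "?w ! i \<in> set u \<union> set v"
      using that by (auto simp: nth_append nth_Cons')
    then show ?thesis by (rule max)
  qed
  have m: "?w ! ?m = M" by simp
  have right: "\<exists>a. x = Suc ?m + a" if "?m < x" for x
    using that less_imp_Suc_add by fastforce
  show "avoids_3_bar5_241 ?w"
    unfolding avoids_3_bar5_241_iff
  proof (intro allI impI, elim conjE)
    fix i j k l
    assume ord: "i < j" "j < k" "k < l" "l < length ?w"
      and pat: "?w ! l < ?w ! j" "?w ! j < ?w ! i" "?w ! i < ?w ! k"
    \<comment> \<open>The letters 3, 2 and 1 each lie below another letter of the occurrence, so the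
      maximum can only play 4. In the third case below it may do so or lie elsewhere between
      \<open>j\<close> and \<open>l\<close>.\<close>
    have "i \<noteq> ?m" using pat le[of k] ord m by auto
    moreover have "j \<noteq> ?m" using pat le[of i] ord m by auto
    moreover have "l \<noteq> ?m" using pat le[of j] ord m by auto
    ultimately consider "?m < i" | "i < ?m" "?m < j" | "j < ?m" "?m < l" | "l < ?m"
      by linarith
    then show "\<exists>p>i. p < j \<and> ?w ! k < ?w ! p"
    proof cases
      case 1
      then obtain a b c d where abcd: "i = Suc ?m + a" "j = Suc ?m + b" "k = Suc ?m + c"
          "l = Suc ?m + d"
        using right[of i] right[of j] right[of k] right[of l] ord by force
      then obtain p where "a < p" "p < b" "v ! c < v ! p"
        using *[unfolded avoids_3_bar5_241_iff, THEN conjunct2, THEN conjunct1, rule_format,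
            of a b c d] ord pat by (auto simp: nth_append)
      then show ?thesis using abcd by (intro exI[of _ "Suc ?m + p"]) (auto simp: nth_append)
    next
      case 2
      then show ?thesis using lt[of k] ord m by (intro exI[of _ ?m]) auto
    next
      case 3
      then have "?w ! l \<in> set v"
        using ord by (auto simp: nth_append nth_Cons')
      moreover from 3 have eq: "?w ! i = u ! i" "?w ! j = u ! j"
        using ord by (simp_all add: nth_append)
      ultimately have "u ! i \<in> {x. \<exists>y\<in>set v. y < x}" "u ! j \<in> {x. \<exists>y\<in>set v. y < x}"
        using pat by (metis (mono_tags, lifting) mem_Collect_eq order_less_trans)+
      then have "u ! i < u ! j"
        using 3 ord * unfolding increasing_on_def by blast
      then show ?thesis using pat eq by simp
    next
      case 4
      then obtain p where "i < p" "p < j" "u ! k < u ! p"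
        using *[unfolded avoids_3_bar5_241_iff, THEN conjunct1, rule_format,
            of i j k l] ord pat by (auto simp: nth_append)
      then show ?thesis using 4 ord by (intro exI[of _ p]) (auto simp: nth_append)
    qed
  qed
qed

section \<open>Counting avoiders whose top letters increase\<close>

text \<open>The alphabet is an arbitrary set because the two sides of the maximum use complementary
  sets of letters.\<close>

definition increasing_avoiders :: "nat set \<Rightarrow> nat set \<Rightarrow> nat list set" where
  "increasing_avoiders A U =
     {w \<in> permutations_of_set A. avoids_3_bar5_241 w \<and> increasing_on U w}"

lemma finite_increasing_avoiders: "finite (increasing_avoiders A U)"
  by (auto simp: increasing_avoiders_def)

lemma in_increasing_avoiders_iff:
  "w \<in> increasing_avoiders A U \<longleftrightarrow>
     set w = A \<and> distinct w \<and> avoids_3_bar5_241 w \<and> increasing_on U w"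
  by (auto simp: increasing_avoiders_def permutations_of_set_def)

definition num_avoiders :: "nat \<Rightarrow> nat \<Rightarrow> nat" where
  "num_avoiders n t = card (increasing_avoiders {..<n} {n - t..<n})"

lemma upper_subset_lessThan_eq:
  fixes V :: "nat set"
  assumes "V \<subseteq> {..<n}" "\<And>x y. x \<in> V \<Longrightarrow> x < y \<Longrightarrow> y < n \<Longrightarrow> y \<in> V"
  shows "V = {n - card V..<n}"
proof (cases "V = {}")
  case False
  have fin: "finite V" using assms(1) finite_subset by blast
  define m where "m = Min V"
  have m: "m \<in> V" "\<And>x. x \<in> V \<Longrightarrow> m \<le> x"
    using fin False by (auto simp: m_def)
  have "y \<in> V" if "m \<le> y" "y < n" for y
    using assms(2)[of m y] m that by (cases "m = y") auto
  then have V: "V = {m..<n}"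
    using m assms(1) by auto
  have "m < n" using m assms(1) by auto
  then show ?thesis by (subst V) (simp add: V)
qed simp

text \<open>Avoidance and increase depend only on relative order, so the words can be relabelled
  along the increasing bijection from \<open>{..<card A}\<close> to \<open>A\<close>. An upward
  closed \<open>U\<close> pulls back to a final segment, which is determined by its size.\<close>

lemma card_increasing_avoiders:
  assumes "finite A" "U \<subseteq> A" "\<And>x y. x \<in> U \<Longrightarrow> x < y \<Longrightarrow> y \<in> A \<Longrightarrow> y \<in> U"
  shows "card (increasing_avoiders A U) = num_avoiders (card A) (card U)"
proof -
  define n where "n = card A"
  obtain h where bij: "bij_betw h {..<n} A" and mono: "strict_mono_on {..<n} h"
    using ex_bij_betw_strict_mono_card[OF assms(1)] unfolding n_def by blast
  have inj: "inj_on h {..<n}" and img: "h ` {..<n} = A"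
    using bij by (auto simp: bij_betw_def)
  have less: "h x < h y \<longleftrightarrow> x < y" if "x < n" "y < n" for x y
    using mono that by (simp add: strict_mono_on_less)
  define V where "V = {x. x < n \<and> h x \<in> U}"
  have hV: "h ` V = U" using img assms(2) by (auto simp: V_def)
  have "card V = card U"
    unfolding hV[symmetric] by (rule card_image[symmetric])
      (rule inj_on_subset[OF inj], auto simp: V_def)
  moreover have "V = {n - card V..<n}"
  proof (rule upper_subset_lessThan_eq)
    fix x y assume "x \<in> V" "x < y" "y < n"
    then show "y \<in> V"
      using assms(3)[of "h x" "h y"] less[of x y] img by (auto simp: V_def)
  qed (auto simp: V_def)
  ultimately have V: "V = {n - card U..<n}" by simp
  have avoids: "avoids_3_bar5_241 (map h w) \<longleftrightarrow> avoids_3_bar5_241 w"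
    and incr: "increasing_on U (map h w) \<longleftrightarrow> increasing_on V w"
    if w: "w \<in> permutations_of_set {..<n}" for w
  proof -
    have nth: "w ! i < n" if "i < length w" for i
      using nth_mem[OF that] permutations_of_setD(1)[OF w] by auto
    show "avoids_3_bar5_241 (map h w) \<longleftrightarrow> avoids_3_bar5_241 w"
      unfolding avoids_3_bar5_241_iff
      by (intro all_cong1 imp_cong conj_cong ex_cong1 refl) (auto simp: nth less)
    show "increasing_on U (map h w) \<longleftrightarrow> increasing_on V w"
      unfolding increasing_on_def
      by (intro all_cong1 imp_cong conj_cong refl) (auto simp: nth less V_def)
  qed
  have "increasing_avoiders A U = map h ` increasing_avoiders {..<n} V"
    unfolding increasing_avoiders_def img[symmetric] permutations_of_set_image_inj[OF inj]
    by (auto simp: avoids incr)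
  moreover have "inj_on (map h) (increasing_avoiders {..<n} V)"
    by (rule inj_on_subset[OF inj_on_map_lists[OF inj]])
      (auto simp: in_increasing_avoiders_iff)
  ultimately show ?thesis
    by (simp add: card_image num_avoiders_def V n_def)
qed

lemma num_avoiders_0: "num_avoiders n 0 = card (S_3_bar5_241 n)"
proof -
  have "S_3_bar5_241 n = increasing_avoiders {1..n} {}"
    by (simp add: S_3_bar5_241_def increasing_avoiders_def increasing_on_def)
  then show ?thesis
    using card_increasing_avoiders[of "{1..n}" "{}"] by simp
qed

lemma num_avoiders_0_0: "num_avoiders 0 0 = 1"
proof -
  have "increasing_avoiders {} {} = {[]}"
    by (auto simp: increasing_avoiders_def increasing_on_def avoids_3_bar5_241_def)
  then show ?thesis by (simp add: num_avoiders_def)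
qed

text \<open>A single letter occurs once in a word without repetitions, so the condition is vacuous.
  This supplies the hypothesis \<open>s1\<close> that closes the recurrence.\<close>

lemma num_avoiders_1: "num_avoiders (Suc n) 1 = num_avoiders (Suc n) 0"
proof -
  have "increasing_avoiders {..<Suc n} {n..<Suc n} = increasing_avoiders {..<Suc n} {}"
    by (auto simp: in_increasing_avoiders_iff increasing_on_def)
      (metis le_less_Suc_eq less_antisym nat_neq_iff nth_eq_iff_index_eq order_less_trans)
  then show ?thesis by (simp add: num_avoiders_def)
qed

text \<open>\<open>Q\<close> is the set of letters of \<open>v\<close>. As \<open>n\<close> is among
  the letters that must increase, none of the others may follow it, whence \<open>Q\<close> lies in
  \<open>{..<n - t}\<close>. This leaves no increase condition on \<open>v\<close>, and the two
  conditions on \<open>u\<close> merge into one.\<close>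

lemma increasing_avoiders_decompose:
  assumes "t \<le> n"
  shows "bij_betw (\<lambda>(Q, u, v). u @ n # v)
    (SIGMA Q:Pow {..<n - t}.
       increasing_avoiders ({..<n} - Q) ({n - t..<n} \<union> above (n - t) Q) \<times>
       increasing_avoiders Q {})
    (increasing_avoiders {..<Suc n} {n - t..<Suc n})"
    (is "bij_betw ?f ?D ?R")
proof -
  have *: "u @ n # v \<in> ?R \<longleftrightarrow> (set v, u, v) \<in> ?D"
    if uv: "set u \<union> set v = {..<n}" "distinct (u @ v)" for u v
  proof -
    have max: "\<And>x. x \<in> set u \<union> set v \<Longrightarrow> x < n" and dist: "distinct u" "distinct v"
      using uv by auto
    have set: "set u = {..<n} - set v" "set (u @ n # v) = {..<Suc n}"
      "distinct (u @ n # v)" "increasing_on {} v"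
      using uv by (auto simp: increasing_on_def)
    have av: "avoids_3_bar5_241 (u @ n # v) \<longleftrightarrow> avoids_3_bar5_241 u \<and> avoids_3_bar5_241 v \<and>
        increasing_on {x. \<exists>y\<in>set v. y < x} u"
      using max dist by (intro avoids_3_bar5_241_append_max) auto
    have incr: "increasing_on {n - t..<Suc n} (u @ n # v) \<longleftrightarrow>
        set v \<inter> {n - t..<Suc n} = {} \<and> increasing_on {n - t..<Suc n} u"
      using max by (intro increasing_on_append_max) auto
    have top: "x \<in> {n - t..<Suc n} \<longleftrightarrow> x \<notin> {..<n - t}" if "x \<in> set v" for x
      using max[of x] that by auto
    have "u @ n # v \<in> ?R \<longleftrightarrow> avoids_3_bar5_241 u \<and> avoids_3_bar5_241 v \<and>
        increasing_on {x. \<exists>y\<in>set v. y < x} u \<and>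
        set v \<inter> {n - t..<Suc n} = {} \<and> increasing_on {n - t..<Suc n} u"
      unfolding in_increasing_avoiders_iff av incr using set(2,3) by blast
    also have "set v \<inter> {n - t..<Suc n} = {} \<longleftrightarrow> set v \<subseteq> {..<n - t}"
      using top by blast
    also have "avoids_3_bar5_241 u \<and> avoids_3_bar5_241 v \<and>
        increasing_on {x. \<exists>y\<in>set v. y < x} u \<and>
        set v \<subseteq> {..<n - t} \<and> increasing_on {n - t..<Suc n} u \<longleftrightarrow>
        set v \<subseteq> {..<n - t} \<and> avoids_3_bar5_241 u \<and> avoids_3_bar5_241 v \<and>
        increasing_on ({n - t..<n} \<union> above (n - t) (set v)) u"
    proof -
      \<comment> \<open>If \<open>Q\<close> is nonempty, it has an element below
        \<open>n - t\<close>, so all top letters already belong to the set forced by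
        \<open>v\<close>. If \<open>Q\<close> is empty, nothing is forced by \<open>v\<close> and
        \<open>above\<close> is empty too.\<close>
      have "increasing_on {x. \<exists>y\<in>set v. y < x} u \<and> increasing_on {n - t..<Suc n} u \<longleftrightarrow>
          increasing_on ({n - t..<n} \<union> above (n - t) (set v)) u"
        if v: "set v \<subseteq> {..<n - t}"
      proof (cases "set v = {}")
        case True
        have "increasing_on {x. \<exists>y\<in>set v. y < x} u"
          by (simp add: True increasing_on_def)
        have "{n - t..<Suc n} \<inter> set u \<subseteq> {n - t..<n}"
          using max by auto
        moreover have "{n - t..<n} \<inter> set u \<subseteq> {n - t..<Suc n}"
          by auto
        ultimately have "increasing_on {n - t..<Suc n} u \<longleftrightarrow> increasing_on {n - t..<n} u"
          using increasing_on_mono by blast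
        with \<open>increasing_on {x. \<exists>y\<in>set v. y < x} u\<close> show ?thesis
          by (simp add: True above_def)
      next
        case False
        then obtain y where y: "y \<in> set v" "y < n - t" using v by (metis equals0I lessThan_iff subsetD)
        have "\<exists>y\<in>set v. y < x" if "n - t \<le> x" for x
          using y that by (intro bexI[of _ y]) auto
        then have "({n - t..<n} \<union> above (n - t) (set v)) \<inter> set u \<subseteq> {x. \<exists>y\<in>set v. y < x}"
          by (auto simp: above_def)
        moreover have "{x. \<exists>y\<in>set v. y < x} \<inter> set u \<subseteq> {n - t..<n} \<union> above (n - t) (set v)"
        proof
          fix x assume "x \<in> {x. \<exists>y\<in>set v. y < x} \<inter> set u"
          then have "x < n" "x \<notin> set v" "\<exists>y\<in>set v. y < x"
            unfolding set(1) by blast+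
          then show "x \<in> {n - t..<n} \<union> above (n - t) (set v)"
            by (cases "x < n - t") (simp_all add: above_def)
        qed
        moreover have "{n - t..<Suc n} \<inter> set u \<subseteq> {n - t..<n} \<union> above (n - t) (set v)"
          using max by auto
        ultimately show ?thesis
          using increasing_on_mono by blast
      qed
      then show ?thesis by blast
    qed
    also have "\<dots> \<longleftrightarrow> (set v, u, v) \<in> ?D"
      using set dist by (auto simp: in_increasing_avoiders_iff)
    finally show ?thesis .
  qed
  have D: "set u \<union> set v = {..<n} \<and> distinct (u @ v) \<and> Q = set v \<and> n \<notin> set u \<and> n \<notin> set v"
    if "(Q, u, v) \<in> ?D" for Q u v
    using that by (auto simp: in_increasing_avoiders_iff)
  \<comment> \<open>The letter \<open>n\<close> occurs in neither part, so the place of the split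
    can be recovered, and \<open>Q\<close> is \<open>set v\<close>.\<close>
  have "inj_on ?f ?D"
  proof (rule inj_onI)
    fix x y assume xy: "x \<in> ?D" "y \<in> ?D" "?f x = ?f y"
    obtain Q u v Q' u' v' where eq: "x = (Q, u, v)" "y = (Q', u', v')"
      by (metis prod_cases3)
    then have "u = u' \<and> v = v'"
      using xy D[of Q u v] D[of Q' u' v'] append_Cons_eq_iff[of n u v u' v'] by auto
    then show "x = y"
      using xy D[of Q u v] D[of Q' u' v'] eq by auto
  qed
  moreover have "?f ` ?D = ?R"
  proof (intro equalityI subsetI)
    fix w assume "w \<in> ?f ` ?D"
    then obtain Q u v where w: "w = u @ n # v" "(Q, u, v) \<in> ?D" by auto
    then show "w \<in> ?R" using D[of Q u v] *[of u v] by auto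
  next
    fix w assume w: "w \<in> ?R"
    then have "n \<in> set w" by (auto simp: in_increasing_avoiders_iff)
    then obtain u v where uv: "w = u @ n # v" by (meson split_list)
    then have "set u \<union> set v = {..<n}" "distinct (u @ v)"
      using w by (auto simp: in_increasing_avoiders_iff lessThan_Suc)
    then have "(set v, u, v) \<in> ?D" using *[of u v] w uv by blast
    then show "w \<in> ?f ` ?D"
      by (rule rev_image_eqI) (simp add: uv)
  qed
  ultimately show ?thesis by (simp add: bij_betw_def)
qed

text \<open>The letters required to increase in \<open>u\<close> form an upward closed subset of its
  alphabet, so only their number matters; the \<open>t\<close> top letters and
  \<open>above (n - t) Q\<close> are disjoint.\<close>

lemma num_avoiders_Suc_Suc:
  assumes "t \<le> n"
  shows "num_avoiders (Suc n) (Suc t) = (\<Sum>Q\<in>Pow {..<n - t}.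
    num_avoiders (card Q) 0 * num_avoiders (n - card Q) (t + card (above (n - t) Q)))"
proof -
  have "num_avoiders (Suc n) (Suc t) = card (increasing_avoiders {..<Suc n} {n - t..<Suc n})"
    by (simp add: num_avoiders_def)
  also have "\<dots> = (\<Sum>Q\<in>Pow {..<n - t}.
      card (increasing_avoiders ({..<n} - Q) ({n - t..<n} \<union> above (n - t) Q)) *
      card (increasing_avoiders Q {}))"
    by (subst bij_betw_same_card[OF increasing_avoiders_decompose[OF assms], symmetric])
      (simp add: finite_increasing_avoiders card_cartesian_product)
  also have "\<dots> = (\<Sum>Q\<in>Pow {..<n - t}.
    num_avoiders (card Q) 0 * num_avoiders (n - card Q) (t + card (above (n - t) Q)))"
  proof (rule sum.cong)
    fix Q assume Q: "Q \<in> Pow {..<n - t}"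
    let ?U = "{n - t..<n} \<union> above (n - t) Q"
    have fin: "finite Q" using Q finite_subset by auto
    have "card (increasing_avoiders ({..<n} - Q) ?U) = num_avoiders (card ({..<n} - Q)) (card ?U)"
    proof (rule card_increasing_avoiders)
      show "?U \<subseteq> {..<n} - Q" using Q by (auto simp: above_def)
      fix x y assume "x \<in> ?U" "x < y" "y \<in> {..<n} - Q"
      then show "y \<in> ?U" by (auto simp: above_def intro: order_less_trans)
    qed simp
    moreover have "card ({..<n} - Q) = n - card Q"
      using Q fin by (subst card_Diff_subset) auto
    moreover have "card ?U = t + card (above (n - t) Q)"
      using assms by (subst card_Un_disjoint) (auto simp: above_def)
    moreover have "card (increasing_avoiders Q {}) = num_avoiders (card Q) 0"
      using card_increasing_avoiders[OF fin, of "{}"] by simp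
    ultimately show "card (increasing_avoiders ({..<n} - Q) ?U) *
        card (increasing_avoiders Q {}) = num_avoiders (card Q) 0 *
        num_avoiders (n - card Q) (t + card (above (n - t) Q))"
      by simp
  qed simp
  finally show ?thesis .
qed

theorem theorem1:
  fixes a :: "nat \<Rightarrow> 'a::{comm_ring_1, ring_char_0}"
  assumes "a 1 = 1"
    and "\<And>n. n \<ge> 1 \<Longrightarrow> a (n + 1) = of_nat (card (S_3_bar5_241 n))"
  shows "left_shift_eigensequence a \<and>
    (\<forall>b :: nat \<Rightarrow> 'a. left_shift_eigensequence b \<longrightarrow> (\<forall>n\<ge>1. b n = a n))"
proof -
  define s :: "nat \<Rightarrow> nat \<Rightarrow> 'a" where "s n t = of_nat (num_avoiders n t)" for n t
  \<comment> \<open>At \<open>n = 0\<close> the prescribed value \<open>a 1 = 1\<close> is the count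
    of the empty word.\<close>
  have a: "a (n + 1) = s n 0" for n
    using assms by (cases n) (auto simp: s_def num_avoiders_0 [symmetric] num_avoiders_0_0)
  have "s (Suc n) 0 = (\<Sum>q\<le>n. s q 0 * (Abs_fps (\<lambda>n. s n 0) ^ (q + 1)) $ (n - q))" for n
  proof (rule fps_coeff_eq_of_subset_recurrence)
    fix n t :: nat assume "t \<le> n"
    then show "s (Suc n) (Suc t) = (\<Sum>Q\<in>Pow {..<n - t}.
        s (card Q) 0 * s (n - card Q) (t + card (above (n - t) Q)))"
      unfolding s_def by (subst num_avoiders_Suc_Suc) simp_all
  qed (simp_all only: s_def num_avoiders_0_0 num_avoiders_1 of_nat_1)
  then have "a (n + 2) = (\<Sum>q\<le>n. a (q + 1) * (Abs_fps (\<lambda>n. a (n + 1)) ^ (q + 1)) $ (n - q))" for n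
    unfolding a using a[of "Suc n"] by simp
  then have eig: "left_shift_eigensequence a"
    unfolding left_shift_eigensequence_iff using assms(1) by blast
  have "b n = a n" if "left_shift_eigensequence b" "n \<ge> 1" for b n
    using left_shift_eigensequence_unique[OF that(1) eig, of "n - 1"] that(2) by simp
  with eig show ?thesis by blast
qed

end
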